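(* If $X$ is a real Hilbert space and $Q:X\to X$ is a positive semidefinite linear operator satisfying $Q^2=I$, then $Q=I$.
   Context: A positive semidefinite operator is a continuous linear self-adjoint operator $Q:X\to X$ with $\langle Qx,x\rangle\ge0$ for all $x\in X$. $I$ is the identity operator on $X$. *)

theory Defs
  imports "HOL-Analysis.Analysis"
begin

(* The library has no Hilbert space class; here it is the sort {real_inner, complete_space}.
   bounded_linear is continuity plus linearity on a normed space. Self-adjointness is written
   out through the inner product, because the library's adjoint is a choice operator that is
   unspecified unless an adjoint has been shown to exist. *)
definition positive_semidefinite :: "('a::real_inner \<Rightarrow> 'a) \<Rightarrow> bool" where
  "positive_semidefinite Q \<longleftrightarrow>
     bounded_linear Q \<and> (\<forall>x y. Q x \<bullet> y = x \<bullet> Q y) \<and> (\<forall>x. Q x \<bullet> x \<ge> 0)"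

end

theory Submission
  imports Defs
begin

text \<open>An involution \<open>Q\<close> sends every difference \<open>Q x - x\<close> to its
  negative, so such a vector, if nonzero, would be an eigenvector for the eigenvalue -1. Positivity
  of the quadratic form excludes negative eigenvalues, hence the difference vanishes.\<close>

theorem corollary6p3:
  fixes Q :: "'a::{real_inner, complete_space} \<Rightarrow> 'a"
  assumes "positive_semidefinite Q"
    and "Q \<circ> Q = id"
  shows "Q = id"
proof
  fix x
  have lin: "bounded_linear Q" and nonneg: "Q y \<bullet> y \<ge> 0" for y
    using assms(1) by (auto simp: positive_semidefinite_def)
  \<comment> \<open>Up to the factor -2, this is the component of \<open>x\<close> in the eigenspace
    of \<open>Q\<close> for -1.\<close>
  define y where "y = Q x - x"
  have "Q (Q x) = x"
    using assms(2) by (metis comp_apply id_apply)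
  then have "Q y = - y"
    by (simp add: y_def linear_diff[OF bounded_linear.linear[OF lin]])
  then have "y \<bullet> y \<le> 0"
    using nonneg[of y] by simp
  then have "y = 0"
    by (metis inner_gt_zero_iff not_less)
  then show "Q x = id x"
    by (simp add: y_def)
qed

end
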